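(* Let $K$ be a field and let $\mathcal{P}$ be a thin polyomino such that whenever two distinct maximal inner intervals of $\mathcal{P}$ intersect, their intersection is a cell. Then $I_{\mathcal{P}}\subset S=K[x_a\mid a\in V(\mathcal{P})]$ is a prime ideal.
   Context: $\mathbb{N}$ is the set of nonnegative integers, and $(i,j)\le (k,l)$ in $\mathbb{N}^2$ means $i\le k$ and $j\le l$. For $a=(i,j)\le b=(k,l)$ put $[a,b]=\{m\in\mathbb{N}^2: a\le m\le b\}$; it is a proper interval if $i<k$ and $j<l$, and then its anti-diagonal vertices are $(i,l)$ and $(k,j)$. A cell is $C=[a,a+(1,1)]$; $V(C)$ is the set of its four vertices and its edges are the four pairs of adjacent vertices. For a finite collection of cells $\mathcal{P}$, $V(\mathcal{P})=\bigcup_{C\in\mathcal{P}}V(C)$. A polyomino is a non-empty finite collection of cells in $(\mathbb{N}\setminus\{0\})^2$ such that any two of its cells $C,D$ are joined by a sequence of cells $C=C_1,\dots,C_m=D$ of the collection with $C_i\cap C_{i+1}$ an edge of both for all $i$. It is thin if it does not contain four cells forming a $2\times 2$ square. An inner interval of $\mathcal{P}$ is a proper interval $[a,b]$ with $a,b\in V(\mathcal{P})$ all of whose cells belong to $\mathcal{P}$; it is maximal if it is maximal under inclusion. Intersections of intervals are intersections of subsets of $\mathbb{N}^2$; "intersect" means the intersection is non-empty. $I_{\mathcal{P}}\subset S$ is the ideal generated by all binomials $x_ax_b-x_cx_d$, where $[a,b]$ ranges over the inner intervals of $\mathcal{P}$ and $c,d$ are the anti-diagonal vertices of $[a,b]$.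 *)

theory Defs
  imports
    "HOL-Library.Poly_Mapping"
    "HOL-Library.Product_Order"
    "HOL-Library.Product_Plus"
    "HOL-Algebra.Ideal"
begin

type_synonym pt = "nat \<times> nat"

text \<open>
  The order on \<^typ>\<open>pt\<close> is the componentwise one, so \<open>{a..b}\<close> is the interval \<open>[a, b]\<close>
  in the sense of the poset \<open>\<nat>\<^sup>2\<close>.  A cell is identified with the set of its four vertices.
\<close>

definition cell :: "pt \<Rightarrow> pt set" where
  "cell a = {a..a + (1, 1)}"

definition is_cell :: "pt set \<Rightarrow> bool" where
  "is_cell C \<longleftrightarrow> (\<exists>a. C = cell a)"

definition edges :: "pt set \<Rightarrow> pt set set" where
  "edges C = {{p, q} | p q. p \<in> C \<and> q \<in> C \<and> (q = p + (1, 0) \<or> q = p + (0, 1))}"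

definition vertices :: "pt set set \<Rightarrow> pt set" where
  "vertices P = \<Union>P"

definition cells_connected :: "pt set set \<Rightarrow> bool" where
  "cells_connected P \<longleftrightarrow>
     (\<forall>C\<in>P. \<forall>D\<in>P. \<exists>cs. cs \<noteq> [] \<and> hd cs = C \<and> last cs = D \<and> set cs \<subseteq> P \<and>
        successively (\<lambda>A B. A \<inter> B \<in> edges A \<and> A \<inter> B \<in> edges B) cs)"

definition polyomino :: "pt set set \<Rightarrow> bool" where
  "polyomino P \<longleftrightarrow>
     P \<noteq> {} \<and> finite P \<and> (\<forall>C\<in>P. is_cell C \<and> C \<subseteq> {i. i > 0} \<times> {j. j > 0}) \<and>
     cells_connected P"

definition thin :: "pt set set \<Rightarrow> bool" where
  "thin P \<longleftrightarrow>
     (\<nexists>a. {cell a, cell (a + (1, 0)), cell (a + (0, 1)), cell (a + (1, 1))} \<subseteq> P)"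

definition proper_interval :: "pt \<Rightarrow> pt \<Rightarrow> bool" where
  "proper_interval a b \<longleftrightarrow> fst a < fst b \<and> snd a < snd b"

definition inner_interval :: "pt set set \<Rightarrow> pt \<Rightarrow> pt \<Rightarrow> bool" where
  "inner_interval P a b \<longleftrightarrow>
     proper_interval a b \<and> a \<in> vertices P \<and> b \<in> vertices P \<and>
     (\<forall>C. is_cell C \<and> C \<subseteq> {a..b} \<longrightarrow> C \<in> P)"

definition maximal_inner_interval :: "pt set set \<Rightarrow> pt set \<Rightarrow> bool" where
  "maximal_inner_interval P I \<longleftrightarrow>
     (\<exists>a b. I = {a..b} \<and> inner_interval P a b) \<and>
     \<not> (\<exists>a b. I \<subset> {a..b} \<and> inner_interval P a b)"

text \<open>
  A polynomial is a finitely supported map from monomials to coefficients, and a monomial a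
  finitely supported map from variables to exponents.
\<close>

type_synonym 'k mpoly = "(pt \<Rightarrow>\<^sub>0 nat) \<Rightarrow>\<^sub>0 'k"

definition var :: "pt \<Rightarrow> 'k::field mpoly" where
  "var a = Poly_Mapping.single (Poly_Mapping.single a 1) 1"

definition poly_ring :: "pt set \<Rightarrow> 'k::field mpoly ring" where
  "poly_ring V =
     \<lparr>carrier = {p. \<forall>m\<in>Poly_Mapping.keys p. Poly_Mapping.keys m \<subseteq> V},
      monoid.mult = (*), one = 1, ring.zero = 0, add = (+)\<rparr>"

definition polyomino_ideal :: "pt set set \<Rightarrow> 'k::field mpoly set" where
  "polyomino_ideal P =
     Idl\<^bsub>poly_ring (vertices P)\<^esub>
       {var a * var b - var (fst a, snd b) * var (fst b, snd a) | a b. inner_interval P a b}"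

end

theory Submission
  imports Defs "HOL-Library.Countable"
begin

text \<open>
  The maximal inner intervals are horizontal strips with two rows of vertices and vertical strips
  with two columns of vertices.  By hypothesis parallel strips are disjoint, and a horizontal and
  a vertical strip that meet cross in a full cell.  Choosing freely a parameter for every crossing
  cell, for every transversal edge outside the crossings, and for each of the two long sides of
  every strip gives a toric map whose kernel contains the ideal.  It is the whole kernel: two
  monomials with the same image are connected by moves that exchange, in one strip, the sides of
  two variables; the horizontal and the vertical moves do not interfere, so cycles of strips
  impose no further condition.
\<close>

section \<open>Pushing a finitely supported map forward along a map of its domain\<close>

text \<open>Used at two levels: on monomials it adds the exponents of variables with equal image, on
  polynomials it is the linear map of monoid algebras induced by a map of monomials.\<close>

definition push :: "('a \<Rightarrow> 'b) \<Rightarrow> ('a \<Rightarrow>\<^sub>0 'c::comm_monoid_add) \<Rightarrow> ('b \<Rightarrow>\<^sub>0 'c)" where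
  "push f p = (\<Sum>k\<in>Poly_Mapping.keys p. Poly_Mapping.single (f k) (Poly_Mapping.lookup p k))"

lemma push_superset:
  assumes "finite A" "Poly_Mapping.keys p \<subseteq> A"
  shows "push f p = (\<Sum>k\<in>A. Poly_Mapping.single (f k) (Poly_Mapping.lookup p k))"
  unfolding push_def
  by (rule sum.mono_neutral_left) (use assms in \<open>auto simp: in_keys_iff\<close>)

lemma push_zero [simp]: "push f 0 = 0"
  by (simp add: push_def)

lemma push_single [simp]: "push f (Poly_Mapping.single k c) = Poly_Mapping.single (f k) c"
  by (subst push_superset[of "{k}"]) auto

lemma push_add: "push f (p + q) = push f p + push f q"
proof -
  let ?A = "Poly_Mapping.keys p \<union> Poly_Mapping.keys q"
  have "push f (p + q) = (\<Sum>k\<in>?A. Poly_Mapping.single (f k) (Poly_Mapping.lookup (p + q) k))"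
    by (rule push_superset) (use keys_add[of p q] in auto)
  also have "\<dots> = push f p + push f q"
    by (simp add: push_superset[of ?A] lookup_add single_add sum.distrib)
  finally show ?thesis .
qed

lemma push_diff:
  fixes p q :: "'a \<Rightarrow>\<^sub>0 'c::ab_group_add"
  shows "push f (p - q) = push f p - push f q"
  using push_add[of f "p - q" q] by (simp add: algebra_simps)

lemma push_sum: "push f (sum g A) = (\<Sum>a\<in>A. push f (g a))"
  by (induction A rule: infinite_finite_induct) (auto simp: push_add)

lemma push_ident: "push (\<lambda>k. k) p = p"
proof (rule poly_mapping_eqI)
  fix k
  show "Poly_Mapping.lookup (push (\<lambda>k. k) p) k = Poly_Mapping.lookup p k"
    by (auto simp: push_def lookup_sum lookup_single when_def in_keys_iff)
qed

lemma push_push: "push g (push f p) = push (\<lambda>k. g (f k)) p"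
  by (simp add: push_def[of f p] push_def[of "\<lambda>k. g (f k)" p] push_sum)

text \<open>By distributivity only products of two single terms matter, and there additivity of
  \<open>f\<close> applies. So an additive \<open>f\<close> induces a ring homomorphism.\<close>

lemma push_mult:
  fixes p q :: "'a::monoid_add \<Rightarrow>\<^sub>0 'c::semiring_0"
  assumes "\<And>m n. f (m + n) = f m + (f n :: 'b::monoid_add)"
  shows "push f (p * q) = push f p * push f q"
proof -
  have "push f (p * q) = push f (push (\<lambda>k. k) p * push (\<lambda>k. k) q)"
    by (simp add: push_ident)
  also have "\<dots> = push f p * push f q"
    by (simp add: push_def[of _ p] push_def[of _ q] sum_product push_sum mult_single assms)
  finally show ?thesis .
qed

text \<open>Natural exponents that fall together cannot cancel. This later allows labels to be read
  off from supports.\<close>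

lemma keys_push_nat:
  fixes m :: "'a \<Rightarrow>\<^sub>0 nat"
  shows "Poly_Mapping.keys (push f m) = f ` Poly_Mapping.keys m"
proof (rule Set.set_eqI)
  fix l
  have "Poly_Mapping.lookup (push f m) l = 0 \<longleftrightarrow> (\<forall>k\<in>Poly_Mapping.keys m. f k \<noteq> l)"
    by (auto simp: push_def lookup_sum lookup_single when_def)
  then show "l \<in> Poly_Mapping.keys (push f m) \<longleftrightarrow> l \<in> f ` Poly_Mapping.keys m"
    unfolding in_keys_iff[of l "push f m"] image_iff by metis
qed

lemma keys_add_nat:
  fixes m n :: "'a \<Rightarrow>\<^sub>0 nat"
  shows "Poly_Mapping.keys (m + n) = Poly_Mapping.keys m \<union> Poly_Mapping.keys n"
  by (auto simp: in_keys_iff lookup_add)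

lemma extract_key:
  fixes m :: "'a \<Rightarrow>\<^sub>0 nat"
  assumes "v \<in> Poly_Mapping.keys m"
  obtains m' where "m = Poly_Mapping.single v 1 + m'"
proof
  show "m = Poly_Mapping.single v 1 + (m - Poly_Mapping.single v 1)"
    using assms
    by (intro poly_mapping_eqI) (auto simp: lookup_add lookup_minus lookup_single when_def in_keys_iff)
qed

lemma monomial_induct [case_names zero add]:
  fixes m :: "'a \<Rightarrow>\<^sub>0 nat"
  assumes zero: "Q 0" and add: "\<And>v n. Q n \<Longrightarrow> Q (Poly_Mapping.single v 1 + n)"
  shows "Q m"
\<comment> \<open>The measure is the total degree; below, both degrees are summed over the keys of
  \<open>m\<close>, where they differ at \<open>v\<close>.\<close>
proof (induction "\<Sum>v\<in>Poly_Mapping.keys m. Poly_Mapping.lookup m v" arbitrary: m rule: less_induct)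
  case less
  show ?case
  proof (cases "m = 0")
    case False
    then obtain v where v: "v \<in> Poly_Mapping.keys m"
      by (metis poly_mapping_eqI lookup_zero in_keys_iff)
    then obtain n where n: "m = Poly_Mapping.single v 1 + n"
      by (rule extract_key)
    have "(\<Sum>v\<in>Poly_Mapping.keys n. Poly_Mapping.lookup n v) = (\<Sum>v\<in>Poly_Mapping.keys m. Poly_Mapping.lookup n v)"
      by (rule sum.mono_neutral_left) (auto simp: n keys_add_nat in_keys_iff)
    also have "\<dots> < (\<Sum>v\<in>Poly_Mapping.keys m. Poly_Mapping.lookup m v)"
      by (rule sum_strict_mono_ex1) (use v in \<open>auto simp: n lookup_add intro!: bexI[of _ v]\<close>)
    finally have "Q n" by (rule less)
    then show ?thesis unfolding n by (rule add)
  qed (use zero in simp)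
qed

section \<open>Ideals of the polynomial ring\<close>

lemma poly_ring_simps [simp]:
  "mult (poly_ring V) = (*)" "one (poly_ring V) = 1"
  "ring.zero (poly_ring V) = 0" "add (poly_ring V) = (+)"
  by (simp_all add: poly_ring_def)

lemma carrier_poly_ring:
  "p \<in> carrier (poly_ring V) \<longleftrightarrow> (\<forall>m\<in>Poly_Mapping.keys p. Poly_Mapping.keys m \<subseteq> V)"
  by (simp add: poly_ring_def)

lemma single_carrier:
  "Poly_Mapping.keys m \<subseteq> V \<Longrightarrow> Poly_Mapping.single m c \<in> carrier (poly_ring V)"
  by (simp add: carrier_poly_ring)

lemma add_carrier:
  assumes "p \<in> carrier (poly_ring V)" "q \<in> carrier (poly_ring V)"
  shows "p + q \<in> carrier (poly_ring V)"
  using assms keys_add[of p q] by (auto simp: carrier_poly_ring)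

lemma uminus_carrier:
  "p \<in> carrier (poly_ring V) \<Longrightarrow> - p \<in> carrier (poly_ring V)"
  by (auto simp: carrier_poly_ring in_keys_iff)

lemma mult_carrier:
  assumes "p \<in> carrier (poly_ring V)" "q \<in> carrier (poly_ring V)"
  shows "p * q \<in> carrier (poly_ring V)"
  unfolding carrier_poly_ring
proof
  fix m assume "m \<in> Poly_Mapping.keys (p * q)"
  then obtain a b where "a \<in> Poly_Mapping.keys p" "b \<in> Poly_Mapping.keys q" "m = a + b"
    using keys_mult[of p q] by blast
  then show "Poly_Mapping.keys m \<subseteq> V"
    using assms by (simp add: carrier_poly_ring keys_add_nat)
qed

lemma cring_poly_ring: "cring (poly_ring V :: 'k::field mpoly ring)"
proof (intro cringI abelian_groupI comm_monoidI; simp?)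
  show "\<exists>q\<in>carrier (poly_ring V). q + p = 0" if "p \<in> carrier (poly_ring V)" for p :: "'k mpoly"
    using that by (intro bexI[of _ "- p"]) (auto simp: uminus_carrier)
qed (simp_all add: add_carrier mult_carrier ac_simps distrib_left distrib_right carrier_poly_ring[of 0]
    carrier_poly_ring[of 1])

lemma poly_ideal_closed:
  fixes I :: "'k::field mpoly set"
  assumes "ideal I (poly_ring V)"
  shows poly_ideal_zero: "0 \<in> I"
    and poly_ideal_add: "p \<in> I \<Longrightarrow> q \<in> I \<Longrightarrow> p + q \<in> I"
    and poly_ideal_mult: "p \<in> I \<Longrightarrow> q \<in> carrier (poly_ring V) \<Longrightarrow> q * p \<in> I"
    and poly_ideal_uminus: "p \<in> I \<Longrightarrow> - p \<in> I"
proof -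
  interpret ideal I "poly_ring V" by fact
  show "0 \<in> I" using additive_subgroup.zero_closed[OF is_additive_subgroup] by simp
  show add: "p \<in> I \<Longrightarrow> q \<in> I \<Longrightarrow> p + q \<in> I" for p q using additive_subgroup.a_closed[OF is_additive_subgroup, of p q] by simp
  show mult: "p \<in> I \<Longrightarrow> q \<in> carrier (poly_ring V) \<Longrightarrow> q * p \<in> I" for p q
    using I_l_closed[of p q] by simp
  have "- 1 \<in> carrier (poly_ring V :: 'k mpoly ring)"
    by (intro uminus_carrier) (simp add: carrier_poly_ring)
  then show "p \<in> I \<Longrightarrow> - p \<in> I" using mult[of p "- 1"] by simp
qed

lemma poly_ideal_sum:
  assumes "ideal I (poly_ring V)" "\<And>a. a \<in> A \<Longrightarrow> g a \<in> I"
  shows "sum g A \<in> (I :: 'k::field mpoly set)"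
  using assms(2)
  by (induction A rule: infinite_finite_induct)
    (auto intro: poly_ideal_zero[OF assms(1)] poly_ideal_add[OF assms(1)])

section \<open>Kernels of monomial maps and primality\<close>

lemma kernel_ideal:
  fixes f :: "(pt \<Rightarrow>\<^sub>0 nat) \<Rightarrow> 'b::monoid_add"
  assumes "\<And>m n. f (m + n) = f m + f n"
  shows "ideal {p \<in> carrier (poly_ring V). push f p = (0 :: 'b \<Rightarrow>\<^sub>0 'k::field)} (poly_ring V)"
proof -
  interpret cring "poly_ring V :: 'k mpoly ring" by (rule cring_poly_ring)
  \<comment> \<open>The subgroup condition in \<open>idealI\<close> uses the abstract inverse of the
    additive monoid, which has to be identified with negation.\<close>
  have inv: "inv\<^bsub>\<lparr>carrier = carrier (poly_ring V), mult = (+), one = 0\<rparr>\<^esub> p = - p" if "p \<in> carrier (poly_ring V)" for p :: "'k mpoly"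
    using that minus_equality[of "- p" p] by (simp add: a_inv_def uminus_carrier)
  have uminus: "push f (- p) = - push f p" for p :: "'k mpoly"
    using push_diff[of f 0 p] by simp
  show ?thesis
    by (intro idealI subgroup.intro)
      (auto simp: ring_axioms push_add push_mult assms add_carrier mult_carrier inv
        uminus uminus_carrier carrier_poly_ring[of 0])
qed

text \<open>
  Replacing every monomial of \<open>p\<close> by a representative of its fibre changes \<open>p\<close> by an element
  of \<open>I\<close>, and the resulting polynomial depends only on \<open>push f p\<close>.
\<close>
lemma kernel_in_ideal:
  fixes I :: "'k::field mpoly set" and f :: "(pt \<Rightarrow>\<^sub>0 nat) \<Rightarrow> 'b"
  assumes I: "ideal I (poly_ring V)"
    and fibre: "\<And>m n. Poly_Mapping.keys m \<subseteq> V \<Longrightarrow> Poly_Mapping.keys n \<subseteq> V \<Longrightarrow> f m = f n \<Longrightarrow>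
      Poly_Mapping.single m 1 - Poly_Mapping.single n 1 \<in> I"
    and p: "p \<in> carrier (poly_ring V)" "push f p = 0"
  shows "p \<in> I"
proof -
  define g where "g l = (SOME n. Poly_Mapping.keys n \<subseteq> V \<and> f n = l)" for l
  have g: "Poly_Mapping.keys (g (f m)) \<subseteq> V \<and> f (g (f m)) = f m" if "Poly_Mapping.keys m \<subseteq> V" for m
    unfolding g_def by (rule someI[of _ m]) (use that in simp)
  \<comment> \<open>The subtracted term vanishes because \<open>push f p = 0\<close>;
    \<open>push_push\<close> rewrites it as a sum over the monomials of \<open>p\<close>.\<close>
  have "p = push (\<lambda>m. m) p - push g (push f p)"
    by (simp add: push_ident p)
  also have "\<dots> = (\<Sum>m\<in>Poly_Mapping.keys p. Poly_Mapping.single 0 (Poly_Mapping.lookup p m) *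
      (Poly_Mapping.single m 1 - Poly_Mapping.single (g (f m)) 1))"
    unfolding push_push by (simp add: push_def sum_subtractf right_diff_distrib mult_single)
  also have "\<dots> \<in> I"
  proof (rule poly_ideal_sum[OF I], rule poly_ideal_mult[OF I])
    fix m assume "m \<in> Poly_Mapping.keys p"
    then have m: "Poly_Mapping.keys m \<subseteq> V" using p(1) by (auto simp: carrier_poly_ring)
    then show "Poly_Mapping.single m 1 - Poly_Mapping.single (g (f m)) 1 \<in> I"
      using g[OF m] by (intro fibre) auto
  qed (simp add: single_carrier)
  finally show ?thesis .
qed

text \<open>Together with \<open>I\<close>, the assumptions \<open>ker\<close> and
  \<open>fibre\<close> make the ideal the kernel of a homomorphism into an integral domain.\<close>

lemma toric_ideal_prime:
  fixes I :: "'k::field mpoly set"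
    and f :: "(pt \<Rightarrow>\<^sub>0 nat) \<Rightarrow> 'b::{ordered_cancel_comm_monoid_add, linorder}"
  assumes I: "ideal I (poly_ring V)"
    and add: "\<And>m n. f (m + n) = f m + f n"
    and ker: "\<And>p. p \<in> I \<Longrightarrow> push f p = 0"
    and fibre: "\<And>m n. Poly_Mapping.keys m \<subseteq> V \<Longrightarrow> Poly_Mapping.keys n \<subseteq> V \<Longrightarrow> f m = f n \<Longrightarrow>
      Poly_Mapping.single m 1 - Poly_Mapping.single n 1 \<in> I"
  shows "primeideal I (poly_ring V)"
proof (rule primeidealI[OF I cring_poly_ring])
  \<comment> \<open>A single term with coefficient 1 is nonzero whatever \<open>f 0\<close> is, so
    the ideal is proper.\<close>
  have "push f (1 :: 'k mpoly) = Poly_Mapping.single (f 0) 1"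
    using push_single[of f 0 "1::'k"] by simp
  then have "push f (1 :: 'k mpoly) \<noteq> 0"
    by (metis lookup_single_eq lookup_zero zero_neq_one)
  then have "1 \<notin> I" using ker by blast
  moreover have "1 \<in> carrier (poly_ring V :: 'k mpoly ring)" by (simp add: carrier_poly_ring)
  ultimately show "carrier (poly_ring V) \<noteq> I" by blast
next
  fix a b :: "'k mpoly"
  assume carr: "a \<in> carrier (poly_ring V)" "b \<in> carrier (poly_ring V)"
    and "a \<otimes>\<^bsub>poly_ring V\<^esub> b \<in> I"
  then have "push f a * push f b = 0" using ker push_mult[of f a b] add by simp
  then have "push f a = 0 \<or> push f b = 0" by simp
  then show "a \<in> I \<or> b \<in> I" using kernel_in_ideal[OF I fibre] carr by blast
qed


section \<open>Exchanging variables within a fibre\<close>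

lemma binomial_single:
  "var a * var b - var c * var d =
    Poly_Mapping.single (Poly_Mapping.single a 1 + Poly_Mapping.single b 1) 1 -
    Poly_Mapping.single (Poly_Mapping.single c 1 + Poly_Mapping.single d 1) (1::'k::field)"
  by (simp add: var_def mult_single)

lemma binomial_trans:
  fixes I :: "'k::field mpoly set"
  assumes "ideal I (poly_ring V)" "Poly_Mapping.single m 1 - Poly_Mapping.single n 1 \<in> I"
    "Poly_Mapping.single n 1 - Poly_Mapping.single l 1 \<in> I"
  shows "Poly_Mapping.single m 1 - Poly_Mapping.single l 1 \<in> I"
  using poly_ideal_add[OF assms] by simp

lemma binomial_shift:
  fixes I :: "'k::field mpoly set"
  assumes "ideal I (poly_ring V)" "Poly_Mapping.single m 1 - Poly_Mapping.single n 1 \<in> I"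
    "Poly_Mapping.keys l \<subseteq> V"
  shows "Poly_Mapping.single (m + l) 1 - Poly_Mapping.single (n + l) 1 \<in> I"
  using poly_ideal_mult[OF assms(1,2) single_carrier[OF assms(3), of 1]]
  by (simp add: right_diff_distrib mult_single add.commute)

text \<open>If \<open>u\<close> has the wrong label, the required one must occur at some
  \<open>w\<close> in the rest of the monomial, and \<open>u\<close>, \<open>w\<close> are exchanged
  there. \<open>Q\<close> carries the labels already corrected, so that the lemma serves for both
  corrections.\<close>

lemma exchange_step:
  fixes I :: "'k::field mpoly set"
  assumes I: "ideal I (poly_ring V)"
    and keys: "Poly_Mapping.keys (Poly_Mapping.single u 1 + m) \<subseteq> V"
    and ex: "lab v \<in> lab ` Poly_Mapping.keys (Poly_Mapping.single u 1 + m)"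
    and Q: "Q u"
    and exch: "\<And>w. w \<in> V \<Longrightarrow> lab u \<noteq> lab v \<Longrightarrow> lab w = lab v \<Longrightarrow>
      \<exists>u'\<in>V. \<exists>w'\<in>V. lab u' = lab v \<and> Q u' \<and> var u * var w - var u' * var w' \<in> I"
  obtains u' m' where "Poly_Mapping.keys (Poly_Mapping.single u' 1 + m') \<subseteq> V" "lab u' = lab v" "Q u'"
    "Poly_Mapping.single (Poly_Mapping.single u 1 + m) 1 -
      Poly_Mapping.single (Poly_Mapping.single u' 1 + m') 1 \<in> I"
proof (cases "lab u = lab v")
  case True
  show ?thesis
    using that[OF keys True Q] poly_ideal_zero[OF I] by simp
next
  case False
  with ex obtain w where "w \<in> Poly_Mapping.keys m" and lw: "lab w = lab v"
    by (auto simp: keys_add_nat)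
  then obtain m1 where m: "m = Poly_Mapping.single w 1 + m1" by (metis extract_key)
  have V: "w \<in> V" "Poly_Mapping.keys m1 \<subseteq> V" using keys by (auto simp: m keys_add_nat)
  obtain u' w' where u': "u' \<in> V" "w' \<in> V" "lab u' = lab v" "Q u'"
      "var u * var w - var u' * var w' \<in> I"
    using exch[OF V(1) False lw] by blast
  show ?thesis
  proof (rule that[of u' "Poly_Mapping.single w' 1 + m1"])
    show "Poly_Mapping.single (Poly_Mapping.single u 1 + m) 1 -
        Poly_Mapping.single (Poly_Mapping.single u' 1 + (Poly_Mapping.single w' 1 + m1)) 1 \<in> I"
      using binomial_shift[OF I u'(5)[unfolded binomial_single] V(2)] by (simp add: m add.assoc)
  qed (use u' V in \<open>auto simp: keys_add_nat\<close>)
qed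

text \<open>
  The sum type keeps the three kinds of target variables apart, and \<^const>\<open>to_nat\<close> makes the
  monomials linearly ordered, which the integral domain instance requires.
\<close>
definition degree_vector ::
  "('v \<Rightarrow> 'a::countable) \<Rightarrow> ('v \<Rightarrow> 'b::countable) \<Rightarrow> ('v \<Rightarrow> 'c::countable) \<Rightarrow>
    ('v \<Rightarrow>\<^sub>0 nat) \<Rightarrow> (nat \<Rightarrow>\<^sub>0 nat)" where
  "degree_vector \<beta> \<eta> \<zeta> m =
     push (\<lambda>v. to_nat (Inl (\<beta> v) :: 'a + 'b + 'c)) m +
     push (\<lambda>v. to_nat (Inr (Inl (\<eta> v)) :: 'a + 'b + 'c)) m +
     push (\<lambda>v. to_nat (Inr (Inr (\<zeta> v)) :: 'a + 'b + 'c)) m"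

lemma degree_vector_add:
  "degree_vector \<beta> \<eta> \<zeta> (m + n) = degree_vector \<beta> \<eta> \<zeta> m + degree_vector \<beta> \<eta> \<zeta> n"
  by (simp add: degree_vector_def push_add algebra_simps)

lemma keys_degree_vector:
  fixes \<beta> :: "'v \<Rightarrow> 'a::countable" and \<eta> :: "'v \<Rightarrow> 'b::countable" and \<zeta> :: "'v \<Rightarrow> 'c::countable"
  shows "Poly_Mapping.keys (degree_vector \<beta> \<eta> \<zeta> m) =
    to_nat ` (Inl ` \<beta> ` Poly_Mapping.keys m \<union> Inr ` Inl ` \<eta> ` Poly_Mapping.keys m \<union>
      Inr ` Inr ` \<zeta> ` Poly_Mapping.keys m :: ('a + 'b + 'c) set)"
  unfolding degree_vector_def keys_add_nat keys_push_nat by (simp only: image_Un image_image)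

text \<open>The encodings \<open>Inl\<close>, \<open>Inr\<close> and \<open>to_nat\<close> are
  injective, so equal supports of degree vectors split into equal label sets of each kind.\<close>

lemma degree_vector_labels:
  fixes \<beta> :: "'v \<Rightarrow> 'a::countable" and \<eta> :: "'v \<Rightarrow> 'b::countable" and \<zeta> :: "'v \<Rightarrow> 'c::countable"
  assumes "degree_vector \<beta> \<eta> \<zeta> m = degree_vector \<beta> \<eta> \<zeta> n" "v \<in> Poly_Mapping.keys n"
  shows "\<beta> v \<in> \<beta> ` Poly_Mapping.keys m" "\<eta> v \<in> \<eta> ` Poly_Mapping.keys m"
    "\<zeta> v \<in> \<zeta> ` Poly_Mapping.keys m"
proof -
  let ?L = "\<lambda>m. Inl ` \<beta> ` Poly_Mapping.keys m \<union> Inr ` Inl ` \<eta> ` Poly_Mapping.keys m \<union>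
      Inr ` Inr ` \<zeta> ` Poly_Mapping.keys m :: ('a + 'b + 'c) set"
  have L: "?L m = ?L n"
    using arg_cong[OF assms(1), of Poly_Mapping.keys] unfolding keys_degree_vector
    by (simp only: inj_image_eq_iff[OF inj_to_nat])
  have "Inl (\<beta> v) \<in> ?L n" "Inr (Inl (\<eta> v)) \<in> ?L n" "Inr (Inr (\<zeta> v)) \<in> ?L n"
    using assms(2) by blast+
  then have "Inl (\<beta> v) \<in> ?L m" "Inr (Inl (\<eta> v)) \<in> ?L m" "Inr (Inr (\<zeta> v)) \<in> ?L m"
    unfolding L .
  then show "\<beta> v \<in> \<beta> ` Poly_Mapping.keys m" "\<eta> v \<in> \<eta> ` Poly_Mapping.keys m"
    "\<zeta> v \<in> \<zeta> ` Poly_Mapping.keys m"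
    by blast+
qed

text \<open>Terms with coefficients 1 and -1 cancel only at the same exponent. Hence exchanges
  modulo the ideal never leave the fibre.\<close>

lemma kernel_binomial:
  assumes "push f (Poly_Mapping.single m 1 - Poly_Mapping.single n (1::'k::field)) = 0"
  shows "f m = f n"
  using assms by (simp add: push_diff) (metis lookup_single_eq lookup_single_not_eq zero_neq_one)

text \<open>
  To connect \<open>m\<close> with \<open>n\<close>, pick a variable \<open>v\<close> of \<open>n\<close>, take a variable of \<open>m\<close> with the same
  \<open>\<beta>\<close>-label, correct its \<open>\<eta>\<close>- and then its \<open>\<zeta>\<close>-label by exchanges until it becomes \<open>v\<close>, and
  cancel \<open>v\<close>.
\<close>
lemma fibre_connected:
  fixes I :: "'k::field mpoly set"
  assumes I: "ideal I (poly_ring V)"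
    and ker: "\<And>p. p \<in> I \<Longrightarrow> push (degree_vector \<beta> \<eta> \<zeta>) p = 0"
    and inj: "\<And>u v. u \<in> V \<Longrightarrow> v \<in> V \<Longrightarrow> \<beta> u = \<beta> v \<Longrightarrow> \<eta> u = \<eta> v \<Longrightarrow> \<zeta> u = \<zeta> v \<Longrightarrow> u = v"
    and exch_\<eta>: "\<And>u v w. \<lbrakk>u \<in> V; v \<in> V; w \<in> V; \<beta> u = \<beta> v; \<eta> u \<noteq> \<eta> v; \<eta> w = \<eta> v\<rbrakk> \<Longrightarrow>
      \<exists>u'\<in>V. \<exists>w'\<in>V. \<eta> u' = \<eta> v \<and> \<beta> u' = \<beta> v \<and> var u * var w - var u' * var w' \<in> I"
    and exch_\<zeta>: "\<And>u v w. \<lbrakk>u \<in> V; v \<in> V; w \<in> V; \<beta> u = \<beta> v; \<zeta> u \<noteq> \<zeta> v; \<zeta> w = \<zeta> v\<rbrakk> \<Longrightarrow>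
      \<exists>u'\<in>V. \<exists>w'\<in>V. \<zeta> u' = \<zeta> v \<and> (\<beta> u' = \<beta> v \<and> \<eta> u' = \<eta> u) \<and> var u * var w - var u' * var w' \<in> I"
  shows "Poly_Mapping.keys m \<subseteq> V \<Longrightarrow> Poly_Mapping.keys n \<subseteq> V \<Longrightarrow>
    degree_vector \<beta> \<eta> \<zeta> m = degree_vector \<beta> \<eta> \<zeta> n \<Longrightarrow>
    Poly_Mapping.single m 1 - Poly_Mapping.single n 1 \<in> I"
proof (induction n arbitrary: m rule: monomial_induct)
  case zero
  have "Poly_Mapping.keys m = {}"
    using arg_cong[OF zero(3), of Poly_Mapping.keys] by (simp add: keys_degree_vector)
  then have "m = 0" by (intro poly_mapping_eqI) (auto simp: in_keys_iff)
  then show ?case using poly_ideal_zero[OF I] by simp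
next
  case (add v n)
  let ?\<psi> = "degree_vector \<beta> \<eta> \<zeta>"
  let ?n = "Poly_Mapping.single v 1 + n"
  have v: "v \<in> Poly_Mapping.keys ?n" and vV: "v \<in> V" and nV: "Poly_Mapping.keys n \<subseteq> V"
    using add.prems by (auto simp: keys_add_nat)
  obtain u where "u \<in> Poly_Mapping.keys m" and \<beta>u: "\<beta> u = \<beta> v"
    using degree_vector_labels(1)[OF add.prems(3) v] by auto
  then obtain m1 where m: "m = Poly_Mapping.single u 1 + m1" by (metis extract_key)
  note mV = add.prems(1)[unfolded m]
  obtain u2 m2 where m2: "Poly_Mapping.keys (Poly_Mapping.single u2 1 + m2) \<subseteq> V" "\<eta> u2 = \<eta> v" "\<beta> u2 = \<beta> v"
    "Poly_Mapping.single m 1 - Poly_Mapping.single (Poly_Mapping.single u2 1 + m2) 1 \<in> I"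
  proof (rule exchange_step[OF I mV, of \<eta> v "\<lambda>x. \<beta> x = \<beta> v"])
    show "\<eta> v \<in> \<eta> ` Poly_Mapping.keys (Poly_Mapping.single u 1 + m1)"
      using degree_vector_labels(2)[OF add.prems(3) v] by (simp add: m)
    fix w assume "w \<in> V" "\<eta> u \<noteq> \<eta> v" "\<eta> w = \<eta> v"
    then show "\<exists>u'\<in>V. \<exists>w'\<in>V. \<eta> u' = \<eta> v \<and> \<beta> u' = \<beta> v \<and> var u * var w - var u' * var w' \<in> I"
      using mV vV \<beta>u by (intro exch_\<eta>) (auto simp: keys_add_nat)
  qed (use \<beta>u in \<open>simp_all add: m\<close>)
  have \<psi>2: "?\<psi> (Poly_Mapping.single u2 1 + m2) = ?\<psi> ?n"
    using kernel_binomial[OF ker[OF m2(4)]] add.prems(3) by simp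
  \<comment> \<open>The second correction must not undo the first, so \<open>Q\<close> now also
    fixes the \<open>\<eta>\<close>-label.\<close>
  obtain u3 m3 where m3: "Poly_Mapping.keys (Poly_Mapping.single u3 1 + m3) \<subseteq> V" "\<zeta> u3 = \<zeta> v"
    "\<beta> u3 = \<beta> v \<and> \<eta> u3 = \<eta> v"
    "Poly_Mapping.single (Poly_Mapping.single u2 1 + m2) 1 - Poly_Mapping.single (Poly_Mapping.single u3 1 + m3) 1 \<in> I"
  proof (rule exchange_step[OF I m2(1), of \<zeta> v "\<lambda>x. \<beta> x = \<beta> v \<and> \<eta> x = \<eta> v"])
    show "\<zeta> v \<in> \<zeta> ` Poly_Mapping.keys (Poly_Mapping.single u2 1 + m2)"
      by (rule degree_vector_labels(3)[OF \<psi>2 v])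
    fix w assume "w \<in> V" "\<zeta> u2 \<noteq> \<zeta> v" "\<zeta> w = \<zeta> v"
    then show "\<exists>u'\<in>V. \<exists>w'\<in>V. \<zeta> u' = \<zeta> v \<and> (\<beta> u' = \<beta> v \<and> \<eta> u' = \<eta> v) \<and> var u2 * var w - var u' * var w' \<in> I"
      using m2(1) vV m2(3) exch_\<zeta>[of u2 v w] by (simp add: keys_add_nat m2(2))
  qed (use m2 in simp_all)
  have u3: "u3 = v"
    using m3 vV by (intro inj) (auto simp: keys_add_nat)
  have m3n: "Poly_Mapping.single m3 1 - Poly_Mapping.single n 1 \<in> I"
  proof (rule add.IH)
    \<comment> \<open>Both sides contain the contribution of \<open>v\<close>, which cancels by
      additivity.\<close>
    show "?\<psi> m3 = ?\<psi> n"
      using kernel_binomial[OF ker[OF m3(4)]] \<psi>2 by (simp add: u3 degree_vector_add)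
  qed (use m3(1) nV in \<open>auto simp: keys_add_nat\<close>)
  have "Poly_Mapping.single (Poly_Mapping.single u3 1 + m3) 1 - Poly_Mapping.single ?n 1 \<in> I"
    using binomial_shift[OF I m3n, of "Poly_Mapping.single v 1"] vV by (simp add: u3 add.commute)
  then show ?case
    using binomial_trans[OF I m2(4)] binomial_trans[OF I m3(4)] by blast
qed


section \<open>Crossing strips\<close>

abbreviation box :: "pt \<times> pt \<Rightarrow> pt set" where
  "box S \<equiv> {fst S..snd S}"

lemma mem_box:
  "v \<in> box S \<longleftrightarrow> fst (fst S) \<le> fst v \<and> fst v \<le> fst (snd S) \<and>
    snd (fst S) \<le> snd v \<and> snd v \<le> snd (snd S)"
  by (auto simp: less_eq_prod_def)

text \<open>This isolates what the toric argument uses. In \<open>crossing\<close>, \<open>S\<close>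
  covers all columns of \<open>T\<close> and \<open>T\<close> covers all rows of
  \<open>S\<close>.\<close>

locale crossing_strips =
  fixes \<H> \<V> :: "(pt \<times> pt) set"
  assumes H_disjoint: "S \<in> \<H> \<Longrightarrow> T \<in> \<H> \<Longrightarrow> v \<in> box S \<Longrightarrow> v \<in> box T \<Longrightarrow> S = T"
    and V_disjoint: "S \<in> \<V> \<Longrightarrow> T \<in> \<V> \<Longrightarrow> v \<in> box S \<Longrightarrow> v \<in> box T \<Longrightarrow> S = T"
    and crossing: "S \<in> \<H> \<Longrightarrow> T \<in> \<V> \<Longrightarrow> v \<in> box S \<Longrightarrow> v \<in> box T \<Longrightarrow>
      fst (fst S) \<le> fst (fst T) \<and> fst (snd T) \<le> fst (snd S) \<and>
      snd (fst T) \<le> snd (fst S) \<and> snd (snd S) \<le> snd (snd T)"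
begin

section \<open>Strips, lattice lines and blocks through a point\<close>

definition hstrip :: "pt \<Rightarrow> (pt \<times> pt) option" where
  "hstrip v = (if \<exists>S\<in>\<H>. v \<in> box S then Some (THE S. S \<in> \<H> \<and> v \<in> box S) else None)"

definition vstrip :: "pt \<Rightarrow> (pt \<times> pt) option" where
  "vstrip v = (if \<exists>S\<in>\<V>. v \<in> box S then Some (THE S. S \<in> \<V> \<and> v \<in> box S) else None)"

lemma hstrip_eq_Some: "hstrip v = Some S \<longleftrightarrow> S \<in> \<H> \<and> v \<in> box S"
proof -
  have "(THE S. S \<in> \<H> \<and> v \<in> box S) = T" if "T \<in> \<H>" "v \<in> box T" for T
    using that by (intro the_equality) (blast intro: H_disjoint)+
  note the = this
  show ?thesis
  proof (cases "\<exists>S\<in>\<H>. v \<in> box S")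
    case True
    then obtain T where T: "T \<in> \<H>" "v \<in> box T" by blast
    then have "hstrip v = Some T" by (simp only: hstrip_def if_P[OF True] the)
    with T show ?thesis by (metis option.inject H_disjoint)
  next
    case False
    then have "hstrip v = None" unfolding hstrip_def by (rule if_not_P)
    with False show ?thesis by (metis option.distinct(1))
  qed
qed

lemma vstrip_eq_Some: "vstrip v = Some S \<longleftrightarrow> S \<in> \<V> \<and> v \<in> box S"
proof -
  have "(THE S. S \<in> \<V> \<and> v \<in> box S) = T" if "T \<in> \<V>" "v \<in> box T" for T
    using that by (intro the_equality) (blast intro: V_disjoint)+
  note the = this
  show ?thesis
  proof (cases "\<exists>S\<in>\<V>. v \<in> box S")
    case True
    then obtain T where T: "T \<in> \<V>" "v \<in> box T" by blast
    then have "vstrip v = Some T" by (simp only: vstrip_def if_P[OF True] the)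
    with T show ?thesis by (metis option.inject V_disjoint)
  next
    case False
    then have "vstrip v = None" unfolding vstrip_def by (rule if_not_P)
    with False show ?thesis by (metis option.distinct(1))
  qed
qed

text \<open>
  The variable \<open>x\<^sub>v\<close> is sent to a product of three variables, indexed by the horizontal and
  vertical lattice lines of the strips through \<open>v\<close> and by the \<^emph>\<open>block\<close> of \<open>v\<close>: the crossing cell of two
  strips, or a single transversal edge of one strip.
\<close>
definition hline :: "pt \<Rightarrow> ((pt \<times> pt) \<times> nat) option" where
  "hline v = map_option (\<lambda>S. (S, snd v)) (hstrip v)"

definition vline :: "pt \<Rightarrow> ((pt \<times> pt) \<times> nat) option" where
  "vline v = map_option (\<lambda>S. (S, fst v)) (vstrip v)"

definition block :: "pt \<Rightarrow> ((pt \<times> pt) option \<times> (pt \<times> pt) option) \<times> nat \<times> nat" where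
  "block v = ((hstrip v, vstrip v),
     case vstrip v of None \<Rightarrow> fst v | Some _ \<Rightarrow> 0,
     case hstrip v of None \<Rightarrow> snd v | Some _ \<Rightarrow> 0)"

text \<open>The row of a point is recorded by \<open>hline\<close> if a horizontal strip passes
  through it and by \<open>block\<close> otherwise; likewise the column by \<open>vline\<close> or
  \<open>block\<close>. The default 0 stands where a line already records the coordinate.\<close>

lemma labels_inj:
  assumes "block u = block v" "hline u = hline v" "vline u = vline v"
  shows "u = v"
  using assms
  by (intro prod_eqI) (auto simp: block_def hline_def vline_def split: option.splits)

text \<open>A vertical strip that meets \<open>S\<close> spans all its rows, so moving inside
  \<open>S\<close> along a column keeps the vertical strip, and \<open>block\<close> forgets the
  row.\<close>

lemma block_hstrip_cong:
  assumes "S \<in> \<H>" "u \<in> box S" "v \<in> box S" "fst u = fst v"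
  shows "block u = block v" "vline u = vline v"
proof -
  have h: "hstrip u = Some S" "hstrip v = Some S"
    using assms by (auto simp: hstrip_eq_Some)
  \<comment> \<open>Used in both directions, this implication also settles the case of
    \<open>None\<close>.\<close>
  have "vstrip u = Some T \<Longrightarrow> vstrip v = Some T" if "u \<in> box S" "v \<in> box S" "fst u = fst v" for u v T
    using that crossing[of S T u] assms(1) unfolding vstrip_eq_Some mem_box by linarith
  from this[of u v] this[of v u] have "vstrip u = vstrip v"
    using assms by (metis option.exhaust)
  with h assms(4) show "block u = block v" "vline u = vline v"
    by (simp_all add: block_def vline_def cong: option.case_cong)
qed

lemma block_vstrip_cong:
  assumes "S \<in> \<V>" "u \<in> box S" "v \<in> box S" "snd u = snd v"
  shows "block u = block v" "hline u = hline v"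
proof -
  have h: "vstrip u = Some S" "vstrip v = Some S"
    using assms by (auto simp: vstrip_eq_Some)
  have "hstrip u = Some T \<Longrightarrow> hstrip v = Some T" if "u \<in> box S" "v \<in> box S" "snd u = snd v" for u v T
    using that crossing[of T S u] assms(1) unfolding hstrip_eq_Some mem_box by linarith
  from this[of u v] this[of v u] have "hstrip u = hstrip v"
    using assms by (metis option.exhaust)
  with h assms(4) show "block u = block v" "hline u = hline v"
    by (simp_all add: block_def hline_def cong: option.case_cong)
qed

lemma hline_cong:
  "S \<in> \<H> \<Longrightarrow> u \<in> box S \<Longrightarrow> v \<in> box S \<Longrightarrow> snd u = snd v \<Longrightarrow> hline u = hline v"
  using hstrip_eq_Some[of u S] hstrip_eq_Some[of v S] by (simp add: hline_def)

lemma vline_cong: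
  "S \<in> \<V> \<Longrightarrow> u \<in> box S \<Longrightarrow> v \<in> box S \<Longrightarrow> fst u = fst v \<Longrightarrow> vline u = vline v"
  using vstrip_eq_Some[of u S] vstrip_eq_Some[of v S] by (simp add: vline_def)

text \<open>Passing to the other diagonal only permutes labels: \<open>hline\<close> follows rows,
  \<open>vline\<close> follows columns, and \<open>block\<close> follows columns in a horizontal
  strip and rows in a vertical one.\<close>

lemma degree_vector_rectangle:
  assumes "S \<in> \<H> \<union> \<V>" "a \<in> box S" "b \<in> box S"
  shows "degree_vector block hline vline (Poly_Mapping.single a 1 + Poly_Mapping.single b 1) =
    degree_vector block hline vline
      (Poly_Mapping.single (fst a, snd b) 1 + Poly_Mapping.single (fst b, snd a) 1)"
proof -
  let ?c = "(fst a, snd b)" and ?d = "(fst b, snd a)"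
  have cd: "?c \<in> box S" "?d \<in> box S"
    using assms(2,3) unfolding mem_box by auto
  consider "S \<in> \<H>" | "S \<in> \<V>" using assms(1) by blast
  then show ?thesis
  proof cases
    case 1
    have "block a = block ?c" "vline a = vline ?c" "block b = block ?d" "vline b = vline ?d"
      "hline a = hline ?d" "hline b = hline ?c"
      using assms(2,3) cd by (auto intro: block_hstrip_cong[OF 1] hline_cong[OF 1])
    then show ?thesis by (simp add: degree_vector_def push_add algebra_simps)
  next
    case 2
    have "block a = block ?d" "hline a = hline ?d" "block b = block ?c" "hline b = hline ?c"
      "vline a = vline ?c" "vline b = vline ?d"
      using assms(2,3) cd by (auto intro: block_vstrip_cong[OF 2] vline_cong[OF 2])
    then show ?thesis by (simp add: degree_vector_def push_add algebra_simps)
  qed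
qed

text \<open>Equal blocks put \<open>u\<close> and \<open>v\<close> in the same strip, and the common
  \<open>hline\<close> puts \<open>w\<close> there too. The corner in the column of \<open>u\<close>
  and the row of \<open>w\<close> keeps the block and gains the right line.\<close>

lemma hline_exchange:
  assumes "block u = block v" "hline u \<noteq> hline v" "hline w = hline v"
  obtains S where "S \<in> \<H>" "u \<in> box S" "w \<in> box S" "(fst u, snd w) \<in> box S"
    "hline (fst u, snd w) = hline v" "block (fst u, snd w) = block v"
proof -
  have huv: "hstrip u = hstrip v" using assms(1) by (simp add: block_def)
  \<comment> \<open>Without a strip both \<open>hline\<close> labels would be \<open>None\<close>,
    hence equal.\<close>
  then obtain S where S: "hstrip u = Some S"
    using assms(2) unfolding hline_def by (metis option.exhaust option.map(1))
  then have "hstrip w = Some S"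
    using assms(3) huv by (auto simp: hline_def)
  with S have S: "S \<in> \<H>" "u \<in> box S" "w \<in> box S" by (auto simp: hstrip_eq_Some)
  then have m: "(fst u, snd w) \<in> box S" unfolding mem_box by auto
  show ?thesis
    using that[OF S m] hline_cong[OF S(1) m S(3)] block_hstrip_cong(1)[OF S(1) m S(2)] assms
    by simp
qed

text \<open>The new point lies in the row of \<open>u\<close> inside a vertical strip, so the
  \<open>hline\<close> label survives as well; this is why rows are corrected before
  columns.\<close>

lemma vline_exchange:
  assumes "block u = block v" "vline u \<noteq> vline v" "vline w = vline v"
  obtains S where "S \<in> \<V>" "u \<in> box S" "w \<in> box S" "(fst w, snd u) \<in> box S"
    "vline (fst w, snd u) = vline v" "block (fst w, snd u) = block v"
    "hline (fst w, snd u) = hline u"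
proof -
  have vuv: "vstrip u = vstrip v" using assms(1) by (simp add: block_def)
  then obtain S where S: "vstrip u = Some S"
    using assms(2) unfolding vline_def by (metis option.exhaust option.map(1))
  then have "vstrip w = Some S"
    using assms(3) vuv by (auto simp: vline_def)
  with S have S: "S \<in> \<V>" "u \<in> box S" "w \<in> box S" by (auto simp: vstrip_eq_Some)
  then have m: "(fst w, snd u) \<in> box S" unfolding mem_box by auto
  show ?thesis
    using that[OF S m] vline_cong[OF S(1) m S(3)] block_vstrip_cong[OF S(1) m S(2)] assms
    by simp
qed

lemma strip_ideal_prime:
  fixes I :: "'k::field mpoly set"
  assumes I: "ideal I (poly_ring V)"
    and ker: "\<And>p. p \<in> I \<Longrightarrow> push (degree_vector block hline vline) p = 0"
    and box_V: "\<And>S. S \<in> \<H> \<union> \<V> \<Longrightarrow> box S \<subseteq> V"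
    and rect: "\<And>S u w. S \<in> \<H> \<union> \<V> \<Longrightarrow> u \<in> box S \<Longrightarrow> w \<in> box S \<Longrightarrow>
      var u * var w - var (fst u, snd w) * var (fst w, snd u) \<in> I"
  shows "primeideal I (poly_ring V)"
proof (rule toric_ideal_prime[OF I degree_vector_add ker fibre_connected[OF I ker]])
  fix u v w assume uvw: "block u = block v" "hline u \<noteq> hline v" "hline w = hline v"
  then obtain S where S: "S \<in> \<H>" "u \<in> box S" "w \<in> box S" "(fst u, snd w) \<in> box S"
    "hline (fst u, snd w) = hline v" "block (fst u, snd w) = block v"
    by (rule hline_exchange)
  have "(fst w, snd u) \<in> box S" using S(2,3) unfolding mem_box by auto
  then have "(fst u, snd w) \<in> V" "(fst w, snd u) \<in> V" using box_V[of S] S by blast+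
  moreover have "var u * var w - var (fst u, snd w) * var (fst w, snd u) \<in> I"
    using S by (intro rect[of S]) auto
  ultimately show "\<exists>u'\<in>V. \<exists>w'\<in>V. hline u' = hline v \<and> block u' = block v \<and>
      var u * var w - var u' * var w' \<in> I"
    using S(5,6) by blast
next
  fix u v w assume uvw: "block u = block v" "vline u \<noteq> vline v" "vline w = vline v"
  then obtain S where S: "S \<in> \<V>" "u \<in> box S" "w \<in> box S" "(fst w, snd u) \<in> box S"
    "vline (fst w, snd u) = vline v" "block (fst w, snd u) = block v"
    "hline (fst w, snd u) = hline u"
    by (rule vline_exchange)
  have "(fst u, snd w) \<in> box S" using S(2,3) unfolding mem_box by auto
  then have "(fst u, snd w) \<in> V" "(fst w, snd u) \<in> V" using box_V[of S] S by blast+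
  moreover have "var u * var w - var (fst w, snd u) * var (fst u, snd w) \<in> I"
    using S rect[of S u w] by (simp add: mult.commute)
  ultimately show "\<exists>u'\<in>V. \<exists>w'\<in>V. vline u' = vline v \<and> (block u' = block v \<and> hline u' = hline u) \<and>
      var u * var w - var u' * var w' \<in> I"
    using S(5-7) by blast
qed (assumption | erule (2) labels_inj)+

end

section \<open>Maximal inner intervals of a thin polyomino\<close>

lemma cell_subset_iff:
  "cell c \<subseteq> {a..b} \<longleftrightarrow> fst a \<le> fst c \<and> fst c < fst b \<and> snd a \<le> snd c \<and> snd c < snd b"
proof -
  have "cell c \<subseteq> {a..b} \<longleftrightarrow> a \<le> c \<and> c + (1, 1) \<le> b"
    unfolding cell_def by (subst atLeastatMost_subset_iff) (auto simp: less_eq_prod_def)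
  then show ?thesis by (auto simp: less_eq_prod_def)
qed

lemma inner_interval_iff:
  "inner_interval P a b \<longleftrightarrow> proper_interval a b \<and> (\<forall>c. cell c \<subseteq> {a..b} \<longrightarrow> cell c \<in> P)"
proof -
  have "a \<in> vertices P \<and> b \<in> vertices P"
    if "proper_interval a b" and P: "\<And>c. cell c \<subseteq> {a..b} \<Longrightarrow> cell c \<in> P"
  proof
    have "a \<in> cell a" by (simp add: cell_def less_eq_prod_def)
    moreover have "cell a \<in> P" using that(1) by (intro P) (auto simp: cell_subset_iff proper_interval_def)
    ultimately show "a \<in> vertices P" by (auto simp: vertices_def)
    \<comment> \<open>This is the cell with upper right vertex \<open>b\<close>; no subtraction
      truncates, since the interval is proper.\<close>
    let ?c = "(fst b - 1, snd b - 1)"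
    have "b \<in> cell ?c" using that(1) by (auto simp: cell_def less_eq_prod_def proper_interval_def)
    moreover have "cell ?c \<in> P" using that(1) by (intro P) (auto simp: cell_subset_iff proper_interval_def)
    ultimately show "b \<in> vertices P" by (auto simp: vertices_def)
  qed
  then show ?thesis unfolding inner_interval_def is_cell_def by blast
qed

lemma inner_interval_subset_vertices:
  assumes "inner_interval P a b"
  shows "{a..b} \<subseteq> vertices P"
proof
  fix v assume v: "v \<in> {a..b}"
  have ab: "fst a < fst b" "snd a < snd b" and P: "\<And>c. cell c \<subseteq> {a..b} \<Longrightarrow> cell c \<in> P"
    using assms by (auto simp: inner_interval_iff proper_interval_def)
  \<comment> \<open>The cell starts at \<open>v\<close>, moved back by one where \<open>v\<close>
    lies on the right or upper side.\<close>
  let ?c = "(min (fst v) (fst b - 1), min (snd v) (snd b - 1))"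
  have "v \<in> cell ?c" using v ab by (auto simp: cell_def less_eq_prod_def)
  moreover have "cell ?c \<in> P" using v ab by (intro P) (auto simp: cell_subset_iff less_eq_prod_def)
  ultimately show "v \<in> vertices P" by (auto simp: vertices_def)
qed

lemma inner_interval_mono:
  assumes "inner_interval P a b" "{c..d} \<subseteq> {a..b}" "proper_interval c d"
  shows "inner_interval P c d"
  using assms unfolding inner_interval_iff by blast

text \<open>Otherwise the 2 x 2 square of cells at the lower left corner would lie in
  \<open>P\<close>.\<close>

lemma thin_inner_interval:
  assumes "thin P" "inner_interval P a b"
  shows "snd b = snd a + 1 \<or> fst b = fst a + 1"
proof (rule ccontr)
  assume "\<not> ?thesis"
  then have "fst a + 1 < fst b" "snd a + 1 < snd b"
    using assms(2) by (auto simp: inner_interval_iff proper_interval_def)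
  moreover have "cell c \<in> P" if "cell c \<subseteq> {a..b}" for c
    using assms(2) that unfolding inner_interval_iff by blast
  ultimately have "{cell a, cell (a + (1, 0)), cell (a + (0, 1)), cell (a + (1, 1))} \<subseteq> P"
    by (simp add: cell_subset_iff)
  then show False using assms(1) unfolding thin_def by blast
qed

lemma inner_interval_subset_maximal:
  assumes "finite (vertices P)" "inner_interval P a b"
  obtains c d where "{a..b} \<subseteq> {c..d}" "inner_interval P c d" "maximal_inner_interval P {c..d}"
proof -
  let ?A = "{I. \<exists>a b. I = {a..b} \<and> inner_interval P a b}"
  have "finite ?A"
    by (rule finite_subset[of _ "Pow (vertices P)"])
      (use assms(1) inner_interval_subset_vertices in \<open>blast, simp\<close>)
  moreover have "{a..b} \<in> ?A" using assms(2) by blast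
  ultimately have "\<exists>I\<in>?A. {a..b} \<subseteq> I \<and> (\<forall>J\<in>?A. I \<subseteq> J \<longrightarrow> I = J)"
    by (rule finite_has_maximal2)
  then obtain I where I: "I \<in> ?A" "{a..b} \<subseteq> I" "\<forall>J\<in>?A. I \<subseteq> J \<longrightarrow> I = J"
    by (elim bexE conjE)
  then have "maximal_inner_interval P I" unfolding maximal_inner_interval_def by blast
  then show ?thesis using I that by blast
qed

text \<open>The intersection is the interval from \<open>sup a c\<close> to \<open>inf b d\<close>,
  and a non-empty interval determines its endpoints. This turns the hypothesis on intersections into
  arithmetic of coordinates.\<close>

lemma Int_eq_cell:
  assumes "{a..b} \<inter> {c..d} = cell e"
  shows "max (fst a) (fst c) = fst e" "max (snd a) (snd c) = snd e"
    "min (fst b) (fst d) = fst e + 1" "min (snd b) (snd d) = snd e + 1"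
proof -
  have "{sup a c..inf b d} = {a..b} \<inter> {c..d}" by auto
  then have "{sup a c..inf b d} = {e..e + (1, 1)}" using assms by (simp add: cell_def)
  moreover have "e \<le> e + (1, 1)" by (simp add: less_eq_prod_def)
  ultimately have "sup a c = e" "inf b d = e + (1, 1)"
    using Icc_eq_Icc[of "sup a c" "inf b d" e "e + (1, 1)"] by blast+
  then have "fst (sup a c) = fst e" "snd (sup a c) = snd e" "fst (inf b d) = fst e + 1"
    "snd (inf b d) = snd e + 1" by simp_all
  then show "max (fst a) (fst c) = fst e" "max (snd a) (snd c) = snd e"
    "min (fst b) (fst d) = fst e + 1" "min (snd b) (snd d) = snd e + 1"
    by (simp_all add: sup_max inf_min)
qed

lemma inner_interval_Icc_eq:
  assumes "inner_interval P a b" "{a..b} = {c..d}"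
  shows "a = c" "b = d"
proof -
  have "a \<le> b" using assms(1) by (auto simp: inner_interval_iff proper_interval_def less_eq_prod_def)
  then show "a = c" "b = d" using assms(2) Icc_eq_Icc[of a b c d] by auto
qed

text \<open>Under \<open>hull\<close> the smallest interval containing both is itself inner, so
  maximality makes each of the two equal to it.\<close>

lemma maximal_inner_interval_hull:
  assumes ab: "inner_interval P a b" "maximal_inner_interval P {a..b}"
    and cd: "inner_interval P c d" "maximal_inner_interval P {c..d}"
    and hull: "\<And>e. cell e \<subseteq> {inf a c..sup b d} \<Longrightarrow> cell e \<subseteq> {a..b} \<or> cell e \<subseteq> {c..d}"
  shows "a = c \<and> b = d"
proof -
  have "inner_interval P (inf a c) (sup b d)"
    using ab(1) cd(1) hull unfolding inner_interval_iff proper_interval_def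
    by (fastforce simp: sup_max inf_min)
  moreover have "{a..b} \<subseteq> {inf a c..sup b d}" "{c..d} \<subseteq> {inf a c..sup b d}"
    by (auto intro: le_infI1 le_infI2 le_supI1 le_supI2)
  ultimately have "{a..b} = {inf a c..sup b d}" "{c..d} = {inf a c..sup b d}"
    using ab(2) cd(2) unfolding maximal_inner_interval_def by blast+
  then have "{a..b} = {c..d}" by metis
  then show ?thesis using inner_interval_Icc_eq[OF ab(1)] by blast
qed


section \<open>Primality of the polyomino ideal\<close>

theorem proposition5p4:
  fixes P :: "pt set set"
  assumes "polyomino P" and "thin P"
    and "\<And>I J. maximal_inner_interval P I \<Longrightarrow> maximal_inner_interval P J \<Longrightarrow> I \<noteq> J \<Longrightarrow>
           I \<inter> J \<noteq> {} \<Longrightarrow> is_cell (I \<inter> J)"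
  shows "primeideal (polyomino_ideal P :: 'k::field mpoly set) (poly_ring (vertices P))"
proof -
  define M where "M = {S. inner_interval P (fst S) (snd S) \<and> maximal_inner_interval P (box S)}"
  \<comment> \<open>A maximal inner interval that is a single cell belongs to both \<open>H\<close>
    and \<open>V\<close>.\<close>
  define H where "H = {S \<in> M. snd (snd S) = snd (fst S) + 1}"
  define V where "V = {S \<in> M. fst (snd S) = fst (fst S) + 1}"
  have fin: "finite (vertices P)"
    unfolding vertices_def
  proof (rule finite_Union)
    show "finite P" using assms(1) by (simp add: polyomino_def)
    fix C assume "C \<in> P"
    then obtain a where "C = cell a" using assms(1) unfolding polyomino_def is_cell_def by blast
    then show "finite C" by (simp add: cell_def atLeastAtMost_prod_eq)
  qed
  have M_inner: "inner_interval P (fst S) (snd S)" if "S \<in> M" for S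
    using that unfolding M_def by blast
  have M_max: "maximal_inner_interval P (box S)" if "S \<in> M" for S
    using that unfolding M_def by blast
  have meet: "\<exists>e. box S \<inter> box T = cell e"
    if M: "S \<in> M" "T \<in> M" and "S \<noteq> T" and v: "v \<in> box S" "v \<in> box T" for S T v
  proof -
    have "box S \<noteq> box T"
    proof
      assume "box S = box T"
      from inner_interval_Icc_eq[OF M_inner[OF M(1)] this] have "S = T" by (rule prod_eqI)
      with \<open>S \<noteq> T\<close> show False ..
    qed
    moreover have "box S \<inter> box T \<noteq> {}" using v by blast
    ultimately have "is_cell (box S \<inter> box T)"
      using assms(3)[OF M_max[OF M(1)] M_max[OF M(2)]] by blast
    then show ?thesis unfolding is_cell_def .
  qed
  have merge: "S = T" if M: "S \<in> M" "T \<in> M"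
    and hull: "\<And>e. cell e \<subseteq> {inf (fst S) (fst T)..sup (snd S) (snd T)} \<Longrightarrow> cell e \<subseteq> box S \<or> cell e \<subseteq> box T"
    for S T
    using maximal_inner_interval_hull[OF M_inner[OF M(1)] M_max[OF M(1)] M_inner[OF M(2)] M_max[OF M(2)] hull]
    by (blast intro: prod_eqI)
  interpret crossing_strips H V
  proof
    fix S T v assume S: "S \<in> H" and T: "T \<in> H" and v: "v \<in> box S" "v \<in> box T"
    show "S = T"
    proof (rule ccontr)
      assume "S \<noteq> T"
      with S T v obtain e where "box S \<inter> box T = cell e" using meet[of S T v] unfolding H_def by blast
      note e = Int_eq_cell[OF this]
      \<comment> \<open>Both strips are one cell high and share a cell, so they occupy the same rows
        and overlap; every cell of their hull lies in one of them.\<close>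
      have "S = T"
      proof (rule merge)
        show "cell c \<subseteq> box S \<or> cell c \<subseteq> box T"
          if "cell c \<subseteq> {inf (fst S) (fst T)..sup (snd S) (snd T)}" for c
          using that e S T unfolding cell_subset_iff H_def by (simp add: sup_max inf_min) linarith
      qed (use S T in \<open>simp_all add: H_def\<close>)
      with \<open>S \<noteq> T\<close> show False ..
    qed
  next
    fix S T v assume S: "S \<in> V" and T: "T \<in> V" and v: "v \<in> box S" "v \<in> box T"
    show "S = T"
    proof (rule ccontr)
      assume "S \<noteq> T"
      with S T v obtain e where "box S \<inter> box T = cell e" using meet[of S T v] unfolding V_def by blast
      note e = Int_eq_cell[OF this]
      have "S = T"
      proof (rule merge)
        show "cell c \<subseteq> box S \<or> cell c \<subseteq> box T"
          if "cell c \<subseteq> {inf (fst S) (fst T)..sup (snd S) (snd T)}" for c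
          using that e S T unfolding cell_subset_iff V_def by (simp add: sup_max inf_min) linarith
      qed (use S T in \<open>simp_all add: V_def\<close>)
      with \<open>S \<noteq> T\<close> show False ..
    qed
  next
    fix S T v assume S: "S \<in> H" and T: "T \<in> V" and v: "v \<in> box S" "v \<in> box T"
    show "fst (fst S) \<le> fst (fst T) \<and> fst (snd T) \<le> fst (snd S) \<and>
      snd (fst T) \<le> snd (fst S) \<and> snd (snd S) \<le> snd (snd T)"
    proof (cases "S = T")
      case False
      with S T v obtain e where "box S \<inter> box T = cell e"
        using meet[of S T v] unfolding H_def V_def by blast
      note e = Int_eq_cell[OF this]
      have "snd (snd S) = snd (fst S) + 1" "fst (snd T) = fst (fst T) + 1"
        using S T unfolding H_def V_def by blast+
      \<comment> \<open>The common cell takes up the full height of \<open>S\<close> and the full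
        width of \<open>T\<close>.\<close>
      with e show ?thesis by linarith
    qed simp
  qed
  \<comment> \<open>Thinness makes the maximal inner interval around \<open>{a..b}\<close> one cell
    high or one cell wide.\<close>
  have inner_in_strip: "\<exists>S\<in>H \<union> V. {a..b} \<subseteq> box S" if ab: "inner_interval P a b" for a b
  proof -
    obtain c d where cd: "{a..b} \<subseteq> {c..d}" "inner_interval P c d" "maximal_inner_interval P {c..d}"
      using inner_interval_subset_maximal[OF fin ab] .
    then have "(c, d) \<in> H \<union> V"
      using thin_inner_interval[OF assms(2) cd(2)] by (simp add: H_def V_def M_def)
    with cd(1) show ?thesis by (intro bexI[of _ "(c, d)"]) simp_all
  qed
  let ?V = "vertices P"
  let ?f = "degree_vector block hline vline"
  let ?G = "{var a * var b - var (fst a, snd b) * var (fst b, snd a) | a b. inner_interval P a b} :: 'k mpoly set"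
  let ?K = "{p \<in> carrier (poly_ring ?V). push ?f p = 0} :: 'k mpoly set"
  interpret R: cring "poly_ring ?V :: 'k mpoly ring" by (rule cring_poly_ring)
  have G: "?G \<subseteq> ?K"
  proof (intro subsetI, elim CollectE exE conjE)
    fix p :: "'k mpoly" and a b
    assume p: "p = var a * var b - var (fst a, snd b) * var (fst b, snd a)" and ab: "inner_interval P a b"
    obtain S where S: "S \<in> H \<union> V" "{a..b} \<subseteq> box S" using inner_in_strip[OF ab] by blast
    have mem: "a \<in> {a..b}" "b \<in> {a..b}" "(fst a, snd b) \<in> {a..b}" "(fst b, snd a) \<in> {a..b}"
      using ab by (auto simp: inner_interval_iff proper_interval_def less_eq_prod_def)
    then have vert: "a \<in> ?V" "b \<in> ?V" "(fst a, snd b) \<in> ?V" "(fst b, snd a) \<in> ?V"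
      using inner_interval_subset_vertices[OF ab] by blast+
    have "p \<in> carrier (poly_ring ?V)"
      unfolding p diff_conv_add_uminus
      by (intro add_carrier uminus_carrier mult_carrier) (simp_all add: var_def single_carrier vert)
    moreover have "push ?f p = 0"
    proof -
      have "a \<in> box S" "b \<in> box S" using S(2) mem by blast+
      from degree_vector_rectangle[OF S(1) this] show ?thesis
        unfolding p binomial_single push_diff push_single by (simp only: diff_self)
    qed
    ultimately show "p \<in> ?K" by blast
  qed
  \<comment> \<open>The kernel is an ideal containing the generators, hence it contains the ideal
    they generate.\<close>
  have "ideal ?K (poly_ring ?V)" by (rule kernel_ideal) (rule degree_vector_add)
  then have IK: "polyomino_ideal P \<subseteq> ?K"
    unfolding polyomino_ideal_def using G by (intro R.genideal_minimal)
  have G_carrier: "?G \<subseteq> carrier (poly_ring ?V)" using G by blast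
  have I: "ideal (polyomino_ideal P) (poly_ring ?V :: 'k mpoly ring)"
    unfolding polyomino_ideal_def using G_carrier by (rule R.genideal_ideal)
  have GI: "?G \<subseteq> polyomino_ideal P"
    unfolding polyomino_ideal_def using G_carrier by (rule R.genideal_self)
  show ?thesis
  proof (rule strip_ideal_prime[OF I])
    fix p :: "'k mpoly" assume "p \<in> polyomino_ideal P"
    then show "push ?f p = 0" using IK by blast
  next
    fix S assume "S \<in> H \<union> V"
    then have "inner_interval P (fst S) (snd S)" using M_inner unfolding H_def V_def by blast
    then show "box S \<subseteq> ?V" by (rule inner_interval_subset_vertices)
  next
    fix S u w assume S: "S \<in> H \<union> V" and uw: "u \<in> box S" "w \<in> box S"
    have inner: "inner_interval P (fst S) (snd S)" using S M_inner unfolding H_def V_def by blast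
    let ?B = "\<lambda>u w. var u * var w - var (fst u, snd w) * var (fst w, snd u) :: 'k mpoly"
    have B: "?B a b \<in> polyomino_ideal P" if "a \<in> box S" "b \<in> box S" "fst a < fst b" "snd a < snd b" for a b
    proof -
      have "inner_interval P a b"
        by (rule inner_interval_mono[OF inner]) (use that in \<open>auto simp: proper_interval_def\<close>)
      then show ?thesis using GI by blast
    qed
    let ?c = "(fst u, snd w)" and ?d = "(fst w, snd u)"
    have cd: "?c \<in> box S" "?d \<in> box S" using uw unfolding mem_box by auto
    note uminus = poly_ideal_uminus[OF I]
    \<comment> \<open>Exchanges produce pairs in any position: a common row or column gives 0,
      reversed diagonal corners give a generator again, and anti-diagonal corners give the negative
      of one.\<close>
    consider "fst u = fst w \<or> snd u = snd w" | "fst u < fst w" "snd u < snd w" | "fst w < fst u" "snd w < snd u"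
      | "fst u < fst w" "snd w < snd u" | "fst w < fst u" "snd u < snd w" by linarith
    then show "?B u w \<in> polyomino_ideal P"
    proof cases
      case 1
      then have "?B u w = 0" by (cases u, cases w) (auto simp: mult.commute)
      then show ?thesis using poly_ideal_zero[OF I] by simp
    next
      case 2
      then show ?thesis by (rule B[OF uw])
    next
      case 3
      then show ?thesis using B[OF uw(2,1)] by (simp add: mult.commute)
    next
      case 4
      then show ?thesis using uminus[OF B[OF cd]] by simp
    next
      case 5
      then show ?thesis using uminus[OF B[OF cd(2,1)]] by (simp add: mult.commute)
    qed
  qed
qed

end
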